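(* Let $\alpha^{(4)}:I\to\mathbb{E}^4$ be a quaternionic curve with first and second curvature functions $K$ and $k$. If $\alpha^{(4)}$ is a quaternionic Mannheim curve, then there is a constant $\lambda\in\mathbb{R}$ such that $$K(s)=\lambda\left\{K^2(s)+k^2(s)\right\}\quad\text{for all } s\in I.$$
   Context: Let $Q_H$ be the algebra of real quaternions $q=a e_1+b e_2+c e_3+d$, with $e_1^2=e_2^2=e_3^2=-1$, $e_1e_2=e_3=-e_2e_1$, $e_2e_3=e_1=-e_3e_2$, $e_3e_1=e_2=-e_1e_3$. Let $\gamma$ be quaternionic conjugation, $\gamma q=-ae_1-be_2-ce_3+d$, and let $h(p,q)=\frac12(p\times\gamma q+q\times\gamma p)$ (where $\times$ is quaternion multiplication), which is the Euclidean inner product. The space $\mathbb{E}^4$ is identified with $Q_H$. A quaternionic curve is a smooth arc-length parametrized curve $\alpha^{(4)}:I\to\mathbb{E}^4$ on an interval $I\subset\mathbb{R}$ with nowhere-zero curvatures $K$ (principal, or first, curvature), $k$ (torsion, or second curvature), $r-K$ (bitorsion) and orthonormal Frenet frame $\{T,N,B_1,B_2\}$ (first to fourth Frenet vectors), $T=(\alpha^{(4)})'$, satisfying $T'=KN$, $N'=-KT+kB_1$, $B_1'=-kN+(r-K)B_2$, $B_2'=-(r-K)B_1$. Here $r-K$ is just the notation for the third curvature function. The corresponding objects for a curve $\beta^{(4)}$ with arc-length parameter $\overline{s}\in\overline{I}$ carry bars: $\overline{T},\overline{N},\overline{B}_1,\overline{B}_2$. A quaternionic curve $\alpha^{(4)}:I\to\mathbb{E}^4$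 is a quaternionic Mannheim curve if there exist a quaternionic curve $\beta^{(4)}:\overline{I}\to\mathbb{E}^4$ (called a quaternionic Mannheim partner curve of $\alpha^{(4)}$) and a bijection $\varphi$ from $\alpha^{(4)}$ to $\beta^{(4)}$, $\varphi(\alpha^{(4)}(s))=\beta^{(4)}(\psi(s))$ with $\psi:I\to\overline{I}$ a smooth bijection with nowhere-zero derivative, such that for every $s\in I$ the second Frenet vector $N(s)$ lies in the plane spanned by the third and fourth Frenet vectors $\overline{B}_1(\psi(s))$, $\overline{B}_2(\psi(s))$ of $\beta^{(4)}$ at the corresponding point, and $\beta^{(4)}(\psi(s))=\alpha^{(4)}(s)+\lambda(s)N(s)$ for some smooth real function $\lambda$ on $I$. *)

theory Defs
  imports "HOL-Analysis.Analysis"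
begin

text \<open>
  Real quaternions on the carrier \<^typ>\<open>real^4\<close>, so that the identification of Euclidean
  4-space with the quaternions is the identity: components 1, 2, 3 are the coefficients of
  $e_1, e_2, e_3$, and component 4 is the scalar part.
\<close>

definition quat :: "real \<Rightarrow> real \<Rightarrow> real \<Rightarrow> real \<Rightarrow> real^4"
  where "quat a b c d = vector [a, b, c, d]"

definition quat_of_real :: "real \<Rightarrow> real^4"
  where "quat_of_real d = quat 0 0 0 d"

definition quat_mult :: "real^4 \<Rightarrow> real^4 \<Rightarrow> real^4"  (infixl "\<times>\<^sub>Q" 70)
  where "p \<times>\<^sub>Q q = quat
    (p$1 * q$4 + p$4 * q$1 + p$2 * q$3 - p$3 * q$2)
    (p$2 * q$4 + p$4 * q$2 + p$3 * q$1 - p$1 * q$3)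
    (p$3 * q$4 + p$4 * q$3 + p$1 * q$2 - p$2 * q$1)
    (p$4 * q$4 - p$1 * q$1 - p$2 * q$2 - p$3 * q$3)"

definition quat_conj :: "real^4 \<Rightarrow> real^4"
  where "quat_conj q = quat (- q$1) (- q$2) (- q$3) (q$4)"

text \<open>The form $h$ is quaternion-valued; \<open>quat_h_eq_inner\<close> below shows that its values are
  scalar and given by the Euclidean inner product.\<close>

definition quat_h :: "real^4 \<Rightarrow> real^4 \<Rightarrow> real^4"
  where "quat_h p q = (1/2) *\<^sub>R (p \<times>\<^sub>Q quat_conj q + q \<times>\<^sub>Q quat_conj p)"

lemma quat_nth [simp]:
  "quat a b c d $ 1 = a" "quat a b c d $ 2 = b" "quat a b c d $ 3 = c" "quat a b c d $ 4 = d"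
  by (simp_all add: quat_def vector_def)

lemma quat_eq_iff: "p = q \<longleftrightarrow> p$1 = q$1 \<and> p$2 = q$2 \<and> p$3 = q$3 \<and> p$4 = q$4"
  for p q :: "real^4"
  by (simp add: vec_eq_iff forall_4)

lemma quat_mult_table:
  fixes e1 e2 e3 :: "real^4"
  defines "e1 \<equiv> quat 1 0 0 0" and "e2 \<equiv> quat 0 1 0 0" and "e3 \<equiv> quat 0 0 1 0"
  shows "e1 \<times>\<^sub>Q e1 = quat_of_real (- 1)" "e2 \<times>\<^sub>Q e2 = quat_of_real (- 1)"
    "e3 \<times>\<^sub>Q e3 = quat_of_real (- 1)"
    "e1 \<times>\<^sub>Q e2 = e3" "e2 \<times>\<^sub>Q e1 = - e3"
    "e2 \<times>\<^sub>Q e3 = e1" "e3 \<times>\<^sub>Q e2 = - e1"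
    "e3 \<times>\<^sub>Q e1 = e2" "e1 \<times>\<^sub>Q e3 = - e2"
    "quat_of_real a \<times>\<^sub>Q q = a *\<^sub>R q" "q \<times>\<^sub>Q quat_of_real a = a *\<^sub>R q"
  by (simp_all add: e1_def e2_def e3_def quat_mult_def quat_of_real_def quat_eq_iff)

lemma quat_h_eq_inner: "quat_h p q = quat_of_real (p \<bullet> q)"
  by (simp add: quat_h_def quat_mult_def quat_conj_def quat_of_real_def quat_eq_iff
      inner_vec_def sum_4 algebra_simps)

text \<open>Infinite differentiability on a set; at the endpoints of an interval the derivatives are
  one-sided.\<close>

definition smooth_on :: "real set \<Rightarrow> (real \<Rightarrow> 'a::real_normed_vector) \<Rightarrow> bool"
  where "smooth_on S f \<longleftrightarrow>
    (\<exists>D. D 0 = f \<and>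
      (\<forall>n. \<forall>s\<in>S. (D n has_vector_derivative D (Suc n) s) (at s within S)))"

text \<open>
  A parametrized curve together with its Frenet apparatus. The frame is carried as data because
  curvatures that are merely nonzero determine the Frenet vectors only up to sign. The field
  \<open>bitors\<close> is the third curvature, traditionally written $r - K$; all functions are relevant on
  \<open>ivl\<close> only.
\<close>

record quat_curve =
  ivl :: "real set"
  pos :: "real \<Rightarrow> real^4"
  tvec :: "real \<Rightarrow> real^4"
  nvec :: "real \<Rightarrow> real^4"
  b1vec :: "real \<Rightarrow> real^4"
  b2vec :: "real \<Rightarrow> real^4"
  curv :: "real \<Rightarrow> real"
  tors :: "real \<Rightarrow> real"
  bitors :: "real \<Rightarrow> real"

definition quat_orthonormal :: "(real^4) list \<Rightarrow> bool"
  where "quat_orthonormal F \<longleftrightarrow>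
    (\<forall>i<length F. \<forall>j<length F. quat_h (F!i) (F!j) = quat_of_real (if i = j then 1 else 0))"

text \<open>Parametrization by arc length is the unit length of \<open>tvec\<close>, which is the derivative of
  \<open>pos\<close>. The interval may be open, closed or half-open, bounded or not, but not empty or a
  single point.\<close>

definition quaternionic_curve :: "quat_curve \<Rightarrow> bool"
  where "quaternionic_curve \<alpha> \<longleftrightarrow>
    is_interval (ivl \<alpha>) \<and> interior (ivl \<alpha>) \<noteq> {} \<and>
    smooth_on (ivl \<alpha>) (pos \<alpha>) \<and>
    (\<forall>s\<in>ivl \<alpha>.
      curv \<alpha> s \<noteq> 0 \<and> tors \<alpha> s \<noteq> 0 \<and> bitors \<alpha> s \<noteq> 0 \<and>
      quat_orthonormal [tvec \<alpha> s, nvec \<alpha> s, b1vec \<alpha> s, b2vec \<alpha> s] \<and>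
      (pos \<alpha> has_vector_derivative tvec \<alpha> s) (at s within ivl \<alpha>) \<and>
      (tvec \<alpha> has_vector_derivative curv \<alpha> s *\<^sub>R nvec \<alpha> s) (at s within ivl \<alpha>) \<and>
      (nvec \<alpha> has_vector_derivative - curv \<alpha> s *\<^sub>R tvec \<alpha> s + tors \<alpha> s *\<^sub>R b1vec \<alpha> s)
        (at s within ivl \<alpha>) \<and>
      (b1vec \<alpha> has_vector_derivative - tors \<alpha> s *\<^sub>R nvec \<alpha> s + bitors \<alpha> s *\<^sub>R b2vec \<alpha> s)
        (at s within ivl \<alpha>) \<and>
      (b2vec \<alpha> has_vector_derivative - bitors \<alpha> s *\<^sub>R b1vec \<alpha> s) (at s within ivl \<alpha>))"

text \<open>Here \<open>\<phi>\<close> is the bijection between the point sets of the two curves and \<open>\<psi>\<close> the induced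
  change of parameter.\<close>

definition mannheim_partner :: "quat_curve \<Rightarrow> quat_curve \<Rightarrow> bool"
  where "mannheim_partner \<alpha> \<beta> \<longleftrightarrow>
    quaternionic_curve \<beta> \<and>
    (\<exists>\<phi> \<psi> lam.
      bij_betw \<phi> (pos \<alpha> ` ivl \<alpha>) (pos \<beta> ` ivl \<beta>) \<and>
      bij_betw \<psi> (ivl \<alpha>) (ivl \<beta>) \<and>
      smooth_on (ivl \<alpha>) \<psi> \<and>
      (\<forall>s\<in>ivl \<alpha>. vector_derivative \<psi> (at s within ivl \<alpha>) \<noteq> 0) \<and>
      smooth_on (ivl \<alpha>) lam \<and>
      (\<forall>s\<in>ivl \<alpha>.
        \<phi> (pos \<alpha> s) = pos \<beta> (\<psi> s) \<and>
        nvec \<alpha> s \<in> span {b1vec \<beta> (\<psi> s), b2vec \<beta> (\<psi> s)} \<and>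
        pos \<beta> (\<psi> s) = pos \<alpha> s + lam s *\<^sub>R nvec \<alpha> s))"

definition quaternionic_mannheim_curve :: "quat_curve \<Rightarrow> bool"
  where "quaternionic_mannheim_curve \<alpha> \<longleftrightarrow>
    quaternionic_curve \<alpha> \<and> (\<exists>\<beta>. mannheim_partner \<alpha> \<beta>)"

end

theory Submission
  imports Defs
begin

text \<open>
  Bars denote the apparatus of the partner curve at the parameter $\psi(s)$. Everything follows
  from the principal normal $N$ being orthogonal to both $\overline{T}$ and $\overline{N}$, since
  it lies in the plane of $\overline{B}_1$ and $\overline{B}_2$. Differentiating
  $\beta \circ \psi = \alpha + \lambda N$ and using the Frenet equation for $N'$ gives
  \[ \psi' \overline{T} = (1 - \lambda K) T + \lambda' N + \lambda k B_1 . \]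

  The $N$-component of this vector vanishes, so $\lambda' = 0$ and $\lambda$ is constant.
  Differentiating $N \cdot \overline{T} = 0$ gives
  $N' \cdot \overline{T} + \psi' \overline{K}\, N \cdot \overline{N} = 0$, hence
  $N' \cdot \overline{T} = 0$. Multiplying by $\psi'$, inserting the displayed expression and
  $N' = -K T + k B_1$ leaves $-K (1 - \lambda K) + \lambda k^2 = 0$, which is the claim.
  Differentiating $N \cdot \overline{T} = 0$, rather than the displayed identity a second time,
  avoids the derivatives of $\psi'$, $K$ and $k$. The steps are
  \<open>normal_orthogonal_partner\<close>, \<open>partner_tangent\<close>, \<open>lam_derivative_eq_0\<close> and
  \<open>partner_tangent_orthogonal_normal_derivative\<close>, combined in \<open>curvature_relation\<close>.
\<close>

lemma quat_orthonormal_iff_inner: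
  "quat_orthonormal F \<longleftrightarrow>
    (\<forall>i<length F. \<forall>j<length F. F!i \<bullet> F!j = (if i = j then 1 else 0))"
  by (simp add: quat_orthonormal_def quat_h_eq_inner quat_of_real_def quat_eq_iff)

lemma quat_orthonormal_frame:
  assumes "quat_orthonormal [t, n, b, b']"
  shows "t \<bullet> t = 1" "n \<bullet> n = 1" "b \<bullet> b = 1"
    "t \<bullet> n = 0" "n \<bullet> t = 0" "t \<bullet> b = 0" "b \<bullet> t = 0" "n \<bullet> b = 0" "b \<bullet> n = 0"
    "b' \<bullet> t = 0" "b' \<bullet> n = 0"
  using assms unfolding quat_orthonormal_iff_inner
  by (simp_all add: All_less_Suc numeral_eq_Suc)

text \<open>This makes derivatives within an interval unique, including the one-sided ones at
  endpoints.\<close>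

lemma at_within_interval_not_bot:
  fixes S :: "real set"
  assumes "is_interval S" "interior S \<noteq> {}" "s \<in> S"
  shows "at s within S \<noteq> bot"
proof -
  have "S \<noteq> {s}"
    using assms(2) by auto
  then have "s islimpt S"
    using connected_imp_perfect[of S s] assms by (auto simp: is_interval_connected)
  then show ?thesis
    by (simp add: trivial_limit_within)
qed

lemma smooth_on_has_vector_derivative:
  assumes "smooth_on S f"
  shows "\<exists>f'. \<forall>s\<in>S. (f has_vector_derivative f' s) (at s within S)"
  using assms unfolding smooth_on_def by metis

text \<open>If \<open>v\<close> is orthogonal along \<open>I\<close> to a curve \<open>w\<close> and, at one point, to the derivative of
  \<open>w\<close>, then the other term of the product rule vanishes there as well.\<close>

lemma inner_derivative_eq_0_of_orthogonal:
  fixes v w :: "real \<Rightarrow> 'a::real_inner"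
  assumes I: "at s within I \<noteq> bot" "s \<in> I"
    and v: "(v has_vector_derivative v') (at s within I)"
    and w: "(w has_vector_derivative w') (at s within I)"
    and orth: "\<And>x. x \<in> I \<Longrightarrow> v x \<bullet> w x = 0" and "v s \<bullet> w' = 0"
  shows "v' \<bullet> w s = 0"
proof -
  have "((\<lambda>x. v x \<bullet> w x) has_vector_derivative v s \<bullet> w' + v' \<bullet> w s) (at s within I)"
    by (rule bounded_bilinear.has_vector_derivative[OF bounded_bilinear_inner v w])
  moreover have "((\<lambda>x. v x \<bullet> w x) has_vector_derivative 0) (at s within I)"
    by (rule has_vector_derivative_transform[OF I(2) _ has_vector_derivative_const[of 0]])
      (simp add: orth)
  ultimately show ?thesis
    using vector_derivative_unique_within[OF I(1)] assms(6) by fastforce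
qed

text \<open>The data whose existence makes \<open>\<beta>\<close> a partner of \<open>\<alpha>\<close>, with names for the derivatives of
  $\psi$ and $\lambda$.\<close>

locale mannheim_offset =
  fixes \<alpha> \<beta> :: quat_curve and \<psi> \<psi>' lam lam' :: "real \<Rightarrow> real"
  assumes curve: "quaternionic_curve \<alpha>" and partner: "quaternionic_curve \<beta>"
    and surj: "\<psi> ` ivl \<alpha> = ivl \<beta>"
    and psi: "\<And>s. s \<in> ivl \<alpha> \<Longrightarrow> (\<psi> has_vector_derivative \<psi>' s) (at s within ivl \<alpha>)"
    and lam: "\<And>s. s \<in> ivl \<alpha> \<Longrightarrow> (lam has_vector_derivative lam' s) (at s within ivl \<alpha>)"
    and plane: "\<And>s. s \<in> ivl \<alpha> \<Longrightarrow> nvec \<alpha> s \<in> span {b1vec \<beta> (\<psi> s), b2vec \<beta> (\<psi> s)}"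
    and offset: "\<And>s. s \<in> ivl \<alpha> \<Longrightarrow> pos \<beta> (\<psi> s) = pos \<alpha> s + lam s *\<^sub>R nvec \<alpha> s"
begin

lemma not_bot: "s \<in> ivl \<alpha> \<Longrightarrow> at s within ivl \<alpha> \<noteq> bot"
  using curve unfolding quaternionic_curve_def by (metis at_within_interval_not_bot)

lemma psi_in_ivl: "s \<in> ivl \<alpha> \<Longrightarrow> \<psi> s \<in> ivl \<beta>"
  using surj by auto

lemmas frame =
  quat_orthonormal_frame[of "tvec \<alpha> s" "nvec \<alpha> s" "b1vec \<alpha> s" "b2vec \<alpha> s" for s]

lemma orthonormal: "s \<in> ivl \<alpha> \<Longrightarrow>
    quat_orthonormal [tvec \<alpha> s, nvec \<alpha> s, b1vec \<alpha> s, b2vec \<alpha> s]"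
  using curve by (simp add: quaternionic_curve_def)

lemma normal_derivative: "s \<in> ivl \<alpha> \<Longrightarrow>
    (nvec \<alpha> has_vector_derivative - curv \<alpha> s *\<^sub>R tvec \<alpha> s + tors \<alpha> s *\<^sub>R b1vec \<alpha> s)
      (at s within ivl \<alpha>)"
  using curve by (simp add: quaternionic_curve_def)

lemma normal_orthogonal_partner:
  assumes s: "s \<in> ivl \<alpha>"
  shows "nvec \<alpha> s \<bullet> tvec \<beta> (\<psi> s) = 0" "nvec \<alpha> s \<bullet> nvec \<beta> (\<psi> s) = 0"
proof -
  have "quat_orthonormal [tvec \<beta> (\<psi> s), nvec \<beta> (\<psi> s), b1vec \<beta> (\<psi> s), b2vec \<beta> (\<psi> s)]"
    using partner psi_in_ivl[OF s] by (simp add: quaternionic_curve_def)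
  note o = quat_orthonormal_frame[OF this]
  obtain a b where "nvec \<alpha> s - a *\<^sub>R b1vec \<beta> (\<psi> s) = b *\<^sub>R b2vec \<beta> (\<psi> s)"
    using plane[OF s] by (auto simp: span_insert span_singleton)
  then have "nvec \<alpha> s = a *\<^sub>R b1vec \<beta> (\<psi> s) + b *\<^sub>R b2vec \<beta> (\<psi> s)"
    by (simp add: algebra_simps)
  then show "nvec \<alpha> s \<bullet> tvec \<beta> (\<psi> s) = 0" "nvec \<alpha> s \<bullet> nvec \<beta> (\<psi> s) = 0"
    using o by (simp_all add: inner_add_left)
qed

lemma partner_derivative:
  assumes s: "s \<in> ivl \<alpha>"
    and f: "(f has_vector_derivative f') (at (\<psi> s) within ivl \<beta>)"
  shows "((\<lambda>x. f (\<psi> x)) has_vector_derivative \<psi>' s *\<^sub>R f') (at s within ivl \<alpha>)"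
  using vector_diff_chain_within[OF psi[OF s], of f f'] f by (simp add: surj o_def)

text \<open>Both sides are the derivative of $\beta \circ \psi = \alpha + \lambda N$.\<close>

lemma partner_tangent:
  assumes s: "s \<in> ivl \<alpha>"
  shows "\<psi>' s *\<^sub>R tvec \<beta> (\<psi> s) =
    (1 - lam s * curv \<alpha> s) *\<^sub>R tvec \<alpha> s + lam' s *\<^sub>R nvec \<alpha> s
      + (lam s * tors \<alpha> s) *\<^sub>R b1vec \<alpha> s"
proof -
  have "(pos \<beta> has_vector_derivative tvec \<beta> (\<psi> s)) (at (\<psi> s) within ivl \<beta>)"
    using partner psi_in_ivl[OF s] by (simp add: quaternionic_curve_def)
  note L = partner_derivative[OF s this]
  have "(pos \<alpha> has_vector_derivative tvec \<alpha> s) (at s within ivl \<alpha>)"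
    using curve s by (simp add: quaternionic_curve_def)
  then have "((\<lambda>x. pos \<alpha> x + lam x *\<^sub>R nvec \<alpha> x) has_vector_derivative
      tvec \<alpha> s + (lam s *\<^sub>R (- curv \<alpha> s *\<^sub>R tvec \<alpha> s + tors \<alpha> s *\<^sub>R b1vec \<alpha> s)
        + lam' s *\<^sub>R nvec \<alpha> s)) (at s within ivl \<alpha>)"
    by (intro has_vector_derivative_add
        bounded_bilinear.has_vector_derivative[OF bounded_bilinear_scaleR]
        lam normal_derivative s)
  then have "((\<lambda>x. pos \<beta> (\<psi> x)) has_vector_derivative
      tvec \<alpha> s + (lam s *\<^sub>R (- curv \<alpha> s *\<^sub>R tvec \<alpha> s + tors \<alpha> s *\<^sub>R b1vec \<alpha> s)
        + lam' s *\<^sub>R nvec \<alpha> s)) (at s within ivl \<alpha>)"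
    by (rule has_vector_derivative_transform[OF s, rotated]) (simp add: offset)
  from vector_derivative_unique_within[OF not_bot[OF s] L this] show ?thesis
    by (simp add: algebra_simps)
qed

lemma lam_derivative_eq_0:
  assumes s: "s \<in> ivl \<alpha>"
  shows "lam' s = 0"
proof -
  have "lam' s = nvec \<alpha> s \<bullet> (\<psi>' s *\<^sub>R tvec \<beta> (\<psi> s))"
    unfolding partner_tangent[OF s] by (simp add: inner_add_right frame[OF orthonormal[OF s]])
  then show ?thesis
    by (simp add: normal_orthogonal_partner[OF s])
qed

text \<open>The derivative of $\overline{T} \circ \psi$ is a multiple of $\overline{N}$, hence
  orthogonal to $N$, so the identity $N \cdot \overline{T} = 0$ can be differentiated with only the
  term containing $N'$ surviving.\<close>

lemma partner_tangent_orthogonal_normal_derivative: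
  assumes s: "s \<in> ivl \<alpha>"
  shows "(- curv \<alpha> s *\<^sub>R tvec \<alpha> s + tors \<alpha> s *\<^sub>R b1vec \<alpha> s) \<bullet> tvec \<beta> (\<psi> s) = 0"
proof -
  have "(tvec \<beta> has_vector_derivative curv \<beta> (\<psi> s) *\<^sub>R nvec \<beta> (\<psi> s)) (at (\<psi> s) within ivl \<beta>)"
    using partner psi_in_ivl[OF s] by (simp add: quaternionic_curve_def)
  from inner_derivative_eq_0_of_orthogonal[OF not_bot[OF s] s normal_derivative[OF s]
      partner_derivative[OF s this]]
  show ?thesis
    by (simp add: normal_orthogonal_partner s)
qed

text \<open>The factor $\psi'$ makes the expansion of \<open>partner_tangent\<close> in the frame of \<open>\<alpha>\<close> available;
  the vanishing of the inner product is not affected by it.\<close>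

lemma curvature_relation:
  assumes s: "s \<in> ivl \<alpha>"
  shows "curv \<alpha> s = lam s * ((curv \<alpha> s)\<^sup>2 + (tors \<alpha> s)\<^sup>2)"
proof -
  have "(- curv \<alpha> s *\<^sub>R tvec \<alpha> s + tors \<alpha> s *\<^sub>R b1vec \<alpha> s) \<bullet> (\<psi>' s *\<^sub>R tvec \<beta> (\<psi> s)) = 0"
    by (simp add: partner_tangent_orthogonal_normal_derivative[OF s, simplified])
  then have "- curv \<alpha> s * (1 - lam s * curv \<alpha> s) + tors \<alpha> s * (lam s * tors \<alpha> s) = 0"
    unfolding partner_tangent[OF s]
    by (simp add: inner_add_right inner_add_left inner_diff_left frame[OF orthonormal[OF s]]
        mult.commute)
  then show ?thesis
    by (simp add: algebra_simps power2_eq_square)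
qed

lemma lam_constant: "\<exists>c. \<forall>s\<in>ivl \<alpha>. lam s = c"
proof -
  have "convex (ivl \<alpha>)"
    using curve by (simp add: quaternionic_curve_def is_interval_convex)
  moreover have "(lam has_vector_derivative 0) (at s within ivl \<alpha>)" if "s \<in> ivl \<alpha>" for s
    using lam[OF that] lam_derivative_eq_0[OF that] by simp
  ultimately show ?thesis
    by (metis has_vector_derivative_zero_constant)
qed

end

theorem theorem3p8:
  fixes \<alpha> :: quat_curve
  assumes "quaternionic_curve \<alpha>"
    and "quaternionic_mannheim_curve \<alpha>"
  shows "\<exists>c::real. \<forall>s\<in>ivl \<alpha>. curv \<alpha> s = c * ((curv \<alpha> s)\<^sup>2 + (tors \<alpha> s)\<^sup>2)"
proof -
  from assms(2) obtain \<beta> \<psi> lam where \<beta>: "quaternionic_curve \<beta>"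
    and bij: "bij_betw \<psi> (ivl \<alpha>) (ivl \<beta>)"
    and sm: "smooth_on (ivl \<alpha>) \<psi>" "smooth_on (ivl \<alpha>) lam"
    and rel: "\<And>s. s \<in> ivl \<alpha> \<Longrightarrow> nvec \<alpha> s \<in> span {b1vec \<beta> (\<psi> s), b2vec \<beta> (\<psi> s)}"
      "\<And>s. s \<in> ivl \<alpha> \<Longrightarrow> pos \<beta> (\<psi> s) = pos \<alpha> s + lam s *\<^sub>R nvec \<alpha> s"
    unfolding quaternionic_mannheim_curve_def mannheim_partner_def by blast
  obtain \<psi>' where "\<And>s. s \<in> ivl \<alpha> \<Longrightarrow> (\<psi> has_vector_derivative \<psi>' s) (at s within ivl \<alpha>)"
    using smooth_on_has_vector_derivative[OF sm(1)] by blast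
  moreover obtain lam' where
    "\<And>s. s \<in> ivl \<alpha> \<Longrightarrow> (lam has_vector_derivative lam' s) (at s within ivl \<alpha>)"
    using smooth_on_has_vector_derivative[OF sm(2)] by blast
  ultimately interpret mannheim_offset \<alpha> \<beta> \<psi> \<psi>' lam lam'
    using assms(1) \<beta> bij rel by unfold_locales (auto simp: bij_betw_imp_surj_on)
  obtain c where "\<And>s. s \<in> ivl \<alpha> \<Longrightarrow> lam s = c"
    using lam_constant by blast
  then show ?thesis
    using curvature_relation by metis
qed

end
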